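(* Let $G$ be a group and $\phi:G\to G$ an endomorphism. Then $H_{alg}(\phi,F)=\mathbf H_{\mathfrak{pet}}(\phi,F)$ for every $F\in\mathcal H(G)$, and so $h_{alg}(\phi)=\mathbf h_{\mathfrak{pet}}(\phi)$.
   Context: $\mathcal H(G)$ is the family of all finite non-empty subsets of $G$. For $F\in\mathcal H(G)$, $T_n(\phi,F)=F\cdot\phi(F)\cdots\phi^{n-1}(F)$ (setwise product), $H_{alg}(\phi,F)=\lim_{n\to\infty}\frac{\log|T_n(\phi,F)|}{n}$ and $h_{alg}(\phi)=\sup\{H_{alg}(\phi,F):F\in\mathcal H(G)\}$. A normed semigroup is a semigroup $(S,\cdot)$ with a function $v:S\to\mathbb R_{\ge0}$; for an endomorphism $\psi:S\to S$, $T_n(\psi,x)=x\cdot\psi(x)\cdots\psi^{n-1}(x)$, $h_{\mathfrak S}(\psi,x)=\limsup_{n\to\infty}\frac{v(T_n(\psi,x))}{n}$ and $h_{\mathfrak S}(\psi)=\sup_{x\in S}h_{\mathfrak S}(\psi,x)$. The covariant functor $\mathfrak{pet}$ sends a group $G$ to the normed monoid $\mathcal H(G)$ under setwise product with norm $v(F)=\log|F|$, and a homomorphism $\phi:G\to H$ to $\mathfrak{pet}(\phi):\mathcal H(G)\to\mathcal H(H)$, $F\mapsto\phi(F)$. The functorial entropy is $\mathbf H_{\mathfrak{pet}}(\phi,F)=h_{\mathfrak S}(\mathfrak{pet}(\phi),F)$ and $\mathbf h_{\mathfrak{pet}}(\phi)=h_{\mathfrak S}(\mathfrak{pet}(\phi))$.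 *)

theory Defs
  imports "HOL-Algebra.Coset" "HOL-Library.Extended_Real"
begin

section \<open>Normed semigroups and their entropy\<close>

text \<open>
  The record extends \<open>monoid\<close> so that \<^const>\<open>hom\<close> and \<^const>\<open>monoid\<close> apply to normed
  monoids; the notions for normed semigroups never use the field \<^const>\<open>one\<close>.
\<close>

record 'a normed_monoid = "'a monoid" +
  nrm :: "'a \<Rightarrow> real"

definition normed_semigroup :: "('a, 'b) normed_monoid_scheme \<Rightarrow> bool" where
  "normed_semigroup S \<longleftrightarrow>
     (\<forall>x\<in>carrier S. \<forall>y\<in>carrier S. x \<otimes>\<^bsub>S\<^esub> y \<in> carrier S) \<and>
     (\<forall>x\<in>carrier S. \<forall>y\<in>carrier S. \<forall>z\<in>carrier S.
        (x \<otimes>\<^bsub>S\<^esub> y) \<otimes>\<^bsub>S\<^esub> z = x \<otimes>\<^bsub>S\<^esub> (y \<otimes>\<^bsub>S\<^esub> z)) \<and>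
     (\<forall>x\<in>carrier S. 0 \<le> nrm S x)"

text \<open>
  The product of \<open>x, \<psi> x, \<dots>, \<psi>\<^sup>n\<^sup>-\<^sup>1 x\<close>. It is meaningful for \<open>n \<ge> 1\<close> only, since a semigroup need
  not have a unit; the value at \<open>0\<close> does not affect the upper limit below.
\<close>

fun sg_traj :: "('a, 'b) normed_monoid_scheme \<Rightarrow> ('a \<Rightarrow> 'a) \<Rightarrow> 'a \<Rightarrow> nat \<Rightarrow> 'a" where
  "sg_traj S \<psi> x 0 = undefined"
| "sg_traj S \<psi> x (Suc 0) = x"
| "sg_traj S \<psi> x (Suc (Suc n)) = sg_traj S \<psi> x (Suc n) \<otimes>\<^bsub>S\<^esub> (\<psi> ^^ Suc n) x"

definition sg_entropy_at ::
  "('a, 'b) normed_monoid_scheme \<Rightarrow> ('a \<Rightarrow> 'a) \<Rightarrow> 'a \<Rightarrow> ereal" where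
  "sg_entropy_at S \<psi> x = limsup (\<lambda>n. ereal (nrm S (sg_traj S \<psi> x n) / real n))"

definition sg_entropy :: "('a, 'b) normed_monoid_scheme \<Rightarrow> ('a \<Rightarrow> 'a) \<Rightarrow> ereal" where
  "sg_entropy S \<psi> = (SUP x\<in>carrier S. sg_entropy_at S \<psi> x)"

section \<open>Algebraic entropy of a group endomorphism\<close>

definition fin_subsets :: "('a, 'b) monoid_scheme \<Rightarrow> 'a set set" where
  "fin_subsets G = {F. F \<subseteq> carrier G \<and> finite F \<and> F \<noteq> {}}"

primrec alg_traj :: "('a, 'b) monoid_scheme \<Rightarrow> ('a \<Rightarrow> 'a) \<Rightarrow> 'a set \<Rightarrow> nat \<Rightarrow> 'a set" where
  "alg_traj G \<phi> F 0 = {\<one>\<^bsub>G\<^esub>}"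
| "alg_traj G \<phi> F (Suc n) = alg_traj G \<phi> F n <#>\<^bsub>G\<^esub> ((\<phi> ^^ n) ` F)"

definition alg_growth :: "('a, 'b) monoid_scheme \<Rightarrow> ('a \<Rightarrow> 'a) \<Rightarrow> 'a set \<Rightarrow> nat \<Rightarrow> real" where
  "alg_growth G \<phi> F n = ln (real (card (alg_traj G \<phi> F n))) / real n"

text \<open>\<^const>\<open>lim\<close> is only meaningful for a convergent sequence.\<close>

definition H_alg :: "('a, 'b) monoid_scheme \<Rightarrow> ('a \<Rightarrow> 'a) \<Rightarrow> 'a set \<Rightarrow> real" where
  "H_alg G \<phi> F = lim (alg_growth G \<phi> F)"

definition h_alg :: "('a, 'b) monoid_scheme \<Rightarrow> ('a \<Rightarrow> 'a) \<Rightarrow> ereal" where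
  "h_alg G \<phi> = (SUP F\<in>fin_subsets G. ereal (H_alg G \<phi> F))"

section \<open>The functor \<open>pet\<close> and its functorial entropy\<close>

definition pet :: "('a, 'b) monoid_scheme \<Rightarrow> 'a set normed_monoid" where
  "pet G = \<lparr>carrier = fin_subsets G, mult = set_mult G, one = {\<one>\<^bsub>G\<^esub>},
            nrm = (\<lambda>F. ln (real (card F)))\<rparr>"

definition pet_map :: "('a \<Rightarrow> 'b) \<Rightarrow> 'a set \<Rightarrow> 'b set" where
  "pet_map \<phi> F = \<phi> ` F"

definition H_pet :: "('a, 'b) monoid_scheme \<Rightarrow> ('a \<Rightarrow> 'a) \<Rightarrow> 'a set \<Rightarrow> ereal" where
  "H_pet G \<phi> F = sg_entropy_at (pet G) (pet_map \<phi>) F"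

definition h_pet :: "('a, 'b) monoid_scheme \<Rightarrow> ('a \<Rightarrow> 'a) \<Rightarrow> ereal" where
  "h_pet G \<phi> = sg_entropy (pet G) (pet_map \<phi>)"

lemma set_mult_in_fin_subsets:
  assumes "group G" "A \<in> fin_subsets G" "B \<in> fin_subsets G"
  shows "A <#>\<^bsub>G\<^esub> B \<in> fin_subsets G"
proof -
  interpret group G by fact
  show ?thesis
    using assms(2,3) set_mult_closed[of A B]
    unfolding fin_subsets_def set_mult_def by auto
qed

lemma monoid_pet:
  assumes "group G"
  shows "monoid (pet G)"
proof -
  interpret group G by fact
  show ?thesis
  proof (rule monoidI)
    fix A B C
    assume "A \<in> carrier (pet G)" "B \<in> carrier (pet G)" "C \<in> carrier (pet G)"
    then show "A \<otimes>\<^bsub>pet G\<^esub> B \<otimes>\<^bsub>pet G\<^esub> C = A \<otimes>\<^bsub>pet G\<^esub> (B \<otimes>\<^bsub>pet G\<^esub> C)"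
      using set_mult_assoc[of A B C] by (auto simp: pet_def fin_subsets_def)
  next
    fix A assume A: "A \<in> carrier (pet G)"
    then have sub: "A \<subseteq> carrier G" by (auto simp: pet_def fin_subsets_def)
    show "\<one>\<^bsub>pet G\<^esub> \<otimes>\<^bsub>pet G\<^esub> A = A"
      using sub by (force simp: pet_def set_mult_def)
    show "A \<otimes>\<^bsub>pet G\<^esub> \<one>\<^bsub>pet G\<^esub> = A"
      using sub by (force simp: pet_def set_mult_def)
  next
    show "\<one>\<^bsub>pet G\<^esub> \<in> carrier (pet G)"
      by (auto simp: pet_def fin_subsets_def)
  qed (simp add: pet_def set_mult_in_fin_subsets[OF assms])
qed

lemma normed_semigroup_pet:
  assumes "group G"
  shows "normed_semigroup (pet G)"
proof -
  interpret P: monoid "pet G" by (rule monoid_pet[OF assms])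
  have "0 \<le> nrm (pet G) F" if "F \<in> carrier (pet G)" for F
  proof -
    have "1 \<le> card F"
      using that by (auto simp: pet_def fin_subsets_def Suc_le_eq card_gt_0_iff)
    then show ?thesis by (simp add: pet_def)
  qed
  then show ?thesis
    unfolding normed_semigroup_def by (simp add: P.m_assoc)
qed

lemma pet_map_hom:
  assumes "\<phi> \<in> hom G H"
  shows "pet_map \<phi> \<in> hom (pet G) (pet H)"
proof (rule homI)
  fix A assume "A \<in> carrier (pet G)"
  then show "pet_map \<phi> A \<in> carrier (pet H)"
    using assms by (auto simp: pet_def pet_map_def fin_subsets_def hom_def)
next
  fix A B assume "A \<in> carrier (pet G)" "B \<in> carrier (pet G)"
  then have mult: "\<phi> (a \<otimes>\<^bsub>G\<^esub> b) = \<phi> a \<otimes>\<^bsub>H\<^esub> \<phi> b" if "a \<in> A" "b \<in> B" for a b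
    using that assms by (auto simp: pet_def fin_subsets_def intro!: hom_mult)
  have "\<phi> ` (A <#>\<^bsub>G\<^esub> B) = (\<Union>a\<in>A. \<Union>b\<in>B. {\<phi> (a \<otimes>\<^bsub>G\<^esub> b)})"
    unfolding set_mult_def by blast
  also have "\<dots> = (\<Union>a\<in>A. \<Union>b\<in>B. {\<phi> a \<otimes>\<^bsub>H\<^esub> \<phi> b})"
    by (simp add: mult)
  also have "\<dots> = \<phi> ` A <#>\<^bsub>H\<^esub> \<phi> ` B"
    unfolding set_mult_def by blast
  finally show "pet_map \<phi> (A \<otimes>\<^bsub>pet G\<^esub> B) = pet_map \<phi> A \<otimes>\<^bsub>pet H\<^esub> pet_map \<phi> B"
    by (simp add: pet_def pet_map_def)
qed

end

theory Submission
  imports Defs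
begin

text \<open>
  The cardinality of the trajectory is submultiplicative, because
  \<open>T\<^sub>m\<^sub>+\<^sub>n = T\<^sub>m \<cdot> \<phi>\<^sup>m(T\<^sub>n)\<close>; so by Fekete's lemma the limit defining \<^const>\<open>H_alg\<close> exists
  and equals the upper limit defining \<^const>\<open>H_pet\<close>.
\<close>

text \<open>Peel off one block of length \<open>k\<close> at a time. Keeping the remainder
  \<open>r\<close> inside \<open>a\<close> makes the case \<open>q = 0\<close> an equality; a bound
  on \<open>a (q * k)\<close> alone would start from \<open>a 0 \<le> 0\<close>, while subadditivity
  only gives \<open>0 \<le> a 0\<close>.\<close>

lemma subadditive_mult_le:
  fixes a :: "nat \<Rightarrow> real"
  assumes sub: "\<And>m n. a (m + n) \<le> a m + a n"
  shows "a (q * k + r) \<le> real q * a k + a r"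
proof (induction q)
  case (Suc q)
  have "a (Suc q * k + r) \<le> a k + a (q * k + r)"
    using sub[of k "q * k + r"] by (simp add: add.assoc)
  with Suc show ?case by (simp add: algebra_simps)
qed simp

text \<open>Fix \<open>k\<close> whose quotient nearly attains the infimum and divide
  \<open>n\<close> by \<open>k\<close> with remainder: \<open>a n / n\<close> exceeds
  \<open>a k / k\<close> by at most a constant over \<open>n\<close>.\<close>

lemma fekete:
  fixes a :: "nat \<Rightarrow> real"
  assumes sub: "\<And>m n. a (m + n) \<le> a m + a n"
    and bdd: "bdd_below ((\<lambda>n. a n / real n) ` {1..})"
  shows "(\<lambda>n. a n / real n) \<longlonglongrightarrow> (INF n\<in>{1..}. a n / real n)"
proof (rule LIMSEQ_I)
  define L where "L = (INF n\<in>{1..}. a n / real n)"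
  fix e :: real assume "e > 0"
  then have "L < L + e / 2" by simp
  then obtain k where k: "k \<ge> 1" "a k / real k < L + e / 2"
    unfolding L_def using bdd by (subst (asm) cINF_less_iff) auto
  \<comment> \<open>A bound independent of \<open>n\<close>: the sum covers \<open>a r\<close> for
    every possible remainder, and the last term covers the error of replacing \<open>q\<close> by
    \<open>n / k\<close>.\<close>
  define M where "M = (\<Sum>r<k. \<bar>a r\<bar>) + \<bar>a k\<bar>"
  have "M \<ge> 0" unfolding M_def by (simp add: sum_nonneg)
  have upper: "a n / real n \<le> a k / real k + M / real n" if "n \<ge> 1" for n
  proof -
    define r where "r = n mod k"
    define q where "q = n div k"
    have n: "n = q * k + r" by (simp add: q_def r_def)
    have "r < k" using k by (simp add: r_def)
    have "real q = (real n - real r) / real k"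
      using k n by (simp add: field_simps)
    then have q: "real q * a k = real n * (a k / real k) - real r / real k * a k"
      by (simp add: diff_divide_distrib left_diff_distrib)
    \<comment> \<open>The sign of \<open>a k\<close> is unknown, so the correction term is bounded
      through its absolute value and \<open>r / k < 1\<close>.\<close>
    have "- (real r / real k * a k) \<le> \<bar>real r / real k * a k\<bar>" by (rule abs_ge_minus_self)
    also have "\<dots> = real r / real k * \<bar>a k\<bar>" by (simp add: abs_mult)
    also have "\<dots> \<le> 1 * \<bar>a k\<bar>"
      using \<open>r < k\<close> by (intro mult_right_mono) (auto simp: field_simps)
    finally have 1: "- (real r / real k * a k) \<le> \<bar>a k\<bar>" by simp
    have "\<bar>a r\<bar> \<le> (\<Sum>r<k. \<bar>a r\<bar>)"
      using \<open>r < k\<close> by (intro member_le_sum) auto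
    then have 2: "a r \<le> (\<Sum>r<k. \<bar>a r\<bar>)" by linarith
    have "a n \<le> real q * a k + a r"
      using subadditive_mult_le[OF sub, of q k r] n by simp
    then have "a n \<le> real n * (a k / real k) + M"
      using 1 2 q unfolding M_def by linarith
    then show ?thesis using that by (simp add: field_simps)
  qed
  obtain N :: nat where N: "real N > 2 * M / e" using reals_Archimedean2 by blast
  \<comment> \<open>The \<open>1\<close> excludes \<open>n = 0\<close>, where the quotient is 0 by
    convention and may lie below \<open>L\<close>.\<close>
  have "norm (a n / real n - L) < e" if "n \<ge> max 1 N" for n
  proof -
    have lower: "L \<le> a n / real n"
      unfolding L_def using bdd that by (intro cINF_lower) auto
    have "real n > 2 * M / e" using N that by linarith
    then have "M / real n < e / 2"
      using that \<open>e > 0\<close> by (simp add: field_simps)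
    with k(2) have "a k / real k + M / real n < (L + e / 2) + e / 2"
      by (rule add_strict_mono)
    with upper[of n] that have "a n / real n < L + e" by simp
    with lower \<open>e > 0\<close> show ?thesis by (simp add: abs_less_iff)
  qed
  then show "\<exists>N. \<forall>n\<ge>N. norm (a n / real n - (INF n\<in>{1..}. a n / real n)) < e"
    unfolding L_def by blast
qed

lemma card_set_mult_le:
  assumes "finite A" "finite B"
  shows "card (A <#>\<^bsub>G\<^esub> B) \<le> card A * card B"
proof -
  have "A <#>\<^bsub>G\<^esub> B = (\<lambda>(x, y). x \<otimes>\<^bsub>G\<^esub> y) ` (A \<times> B)"
    unfolding set_mult_def by auto
  then show ?thesis
    using assms card_image_le[of "A \<times> B"] by (simp add: card_cartesian_product)
qed

lemma funpow_hom:
  assumes "\<phi> \<in> hom G G"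
  shows "\<phi> ^^ n \<in> hom G G"
  by (induction n) (use assms in \<open>auto simp: hom_def Pi_iff\<close>)

lemma image_fin_subsets:
  assumes "\<phi> \<in> hom G H" "A \<in> fin_subsets G"
  shows "\<phi> ` A \<in> fin_subsets H"
  using assms by (auto simp: fin_subsets_def hom_def)

context
  fixes G :: "('a, 'b) monoid_scheme" and \<phi> :: "'a \<Rightarrow> 'a" and F :: "'a set"
  assumes grp: "group G" and hom: "\<phi> \<in> hom G G" and F: "F \<in> fin_subsets G"
begin

interpretation group G by (fact grp)

lemma alg_traj_in: "alg_traj G \<phi> F n \<in> fin_subsets G"
proof (induction n)
  case 0
  show ?case by (simp add: fin_subsets_def)
next
  case (Suc n)
  then show ?case
    using set_mult_in_fin_subsets[OF grp] image_fin_subsets[OF funpow_hom[OF hom] F] by simp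
qed

text \<open>The last \<open>n\<close> factors are the images under \<open>\<phi> ^^ m\<close> of the
  first \<open>n\<close>, and a homomorphism maps a setwise product onto the product of the images.
  The induction is on \<open>n\<close> because trajectories grow on the right.\<close>

lemma alg_traj_add:
  "alg_traj G \<phi> F (m + n) = alg_traj G \<phi> F m <#>\<^bsub>G\<^esub> (\<phi> ^^ m) ` alg_traj G \<phi> F n"
proof (induction n)
  case 0
  have "(\<phi> ^^ m) \<one>\<^bsub>G\<^esub> = \<one>\<^bsub>G\<^esub>"
    using hom_one[OF funpow_hom[OF hom] grp grp] .
  moreover have "A <#>\<^bsub>G\<^esub> {\<one>\<^bsub>G\<^esub>} = A" if "A \<in> fin_subsets G" for A
    using monoid.r_one[OF monoid_pet[OF grp], of A] that by (simp add: pet_def)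
  ultimately show ?case using alg_traj_in by simp
next
  case (Suc n)
  let ?T = "alg_traj G \<phi> F"
  note img = image_fin_subsets[OF funpow_hom[OF hom]]
  have "(\<phi> ^^ (m + n)) ` F = (\<phi> ^^ m) ` (\<phi> ^^ n) ` F"
    by (simp add: funpow_add image_comp)
  then have "?T (m + Suc n) = (?T m <#>\<^bsub>G\<^esub> (\<phi> ^^ m) ` ?T n) <#>\<^bsub>G\<^esub> (\<phi> ^^ m) ` (\<phi> ^^ n) ` F"
    using Suc by simp
  also have "\<dots> = ?T m <#>\<^bsub>G\<^esub> ((\<phi> ^^ m) ` ?T n <#>\<^bsub>G\<^esub> (\<phi> ^^ m) ` (\<phi> ^^ n) ` F)"
    using alg_traj_in[of m] img[OF alg_traj_in] img[OF img[OF F]]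
    by (intro set_mult_assoc) (simp_all add: fin_subsets_def)
  also have "(\<phi> ^^ m) ` ?T n <#>\<^bsub>G\<^esub> (\<phi> ^^ m) ` (\<phi> ^^ n) ` F = (\<phi> ^^ m) ` ?T (Suc n)"
    using set_mult_hom[OF funpow_hom[OF hom]] alg_traj_in[of n]
      image_fin_subsets[OF funpow_hom[OF hom, of n] F] by (simp add: fin_subsets_def)
  finally show ?case .
qed

lemma card_alg_traj_pos: "card (alg_traj G \<phi> F n) > 0"
  using alg_traj_in[of n] by (simp add: fin_subsets_def card_gt_0_iff)

text \<open>Cardinality can only drop, both when products coincide and when
  \<open>\<phi> ^^ m\<close> identifies elements; the logarithm turns the product bound into a
  sum.\<close>

lemma ln_card_alg_traj_subadditive:
  "ln (real (card (alg_traj G \<phi> F (m + n)))) \<le>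
     ln (real (card (alg_traj G \<phi> F m))) + ln (real (card (alg_traj G \<phi> F n)))"
proof -
  let ?c = "\<lambda>n. card (alg_traj G \<phi> F n)"
  have fin: "finite (alg_traj G \<phi> F n)" for n
    using alg_traj_in by (simp add: fin_subsets_def)
  have "?c (m + n) \<le> ?c m * card ((\<phi> ^^ m) ` alg_traj G \<phi> F n)"
    unfolding alg_traj_add using fin by (intro card_set_mult_le) auto
  also have "\<dots> \<le> ?c m * ?c n"
    using fin by (intro mult_left_mono card_image_le) auto
  finally have "real (?c (m + n)) \<le> real (?c m) * real (?c n)"
    by (metis of_nat_le_iff of_nat_mult)
  then have "ln (real (?c (m + n))) \<le> ln (real (?c m) * real (?c n))"
    using card_alg_traj_pos by (intro ln_mono) auto
  also have "\<dots> = ln (real (?c m)) + ln (real (?c n))"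
    using card_alg_traj_pos[of m] card_alg_traj_pos[of n] by (simp add: ln_mult)
  finally show ?thesis .
qed

text \<open>This makes the \<open>lim\<close> in \<open>H_alg\<close> a genuine limit. Trajectories
  are nonempty, so their log-cardinalities are bounded below by 0 and Fekete's lemma
  applies.\<close>

lemma convergent_alg_growth: "convergent (alg_growth G \<phi> F)"
proof -
  have "0 \<le> ln (real (card (alg_traj G \<phi> F n)))" for n
    using card_alg_traj_pos[of n] by (simp add: Suc_le_eq)
  then have "bdd_below ((\<lambda>n. ln (real (card (alg_traj G \<phi> F n))) / real n) ` {1..})"
    by (intro bdd_belowI[of _ 0]) auto
  from fekete[OF ln_card_alg_traj_subadditive this] show ?thesis
    unfolding alg_growth_def by (rule convergentI)
qed

text \<open>Only positive lengths are compared, since \<open>sg_traj\<close> is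
  \<open>undefined\<close> at 0. At length 1 the extra factor \<open>{\<one>}\<close> of
  \<open>alg_traj\<close> disappears by the unit law of \<open>pet G\<close>.\<close>

lemma sg_traj_pet: "sg_traj (pet G) (pet_map \<phi>) F (Suc n) = alg_traj G \<phi> F (Suc n)"
proof (induction n)
  case 0
  show ?case
    using monoid.l_one[OF monoid_pet[OF grp], of F] F by (simp add: pet_def)
next
  case (Suc n)
  have "(pet_map \<phi> ^^ k) F = (\<phi> ^^ k) ` F" for k
    by (induction k) (simp_all add: pet_map_def image_comp)
  then have "sg_traj (pet G) (pet_map \<phi>) F (Suc (Suc n)) =
      sg_traj (pet G) (pet_map \<phi>) F (Suc n) <#>\<^bsub>G\<^esub> (\<phi> ^^ Suc n) ` F"
    by (simp add: pet_def del: funpow.simps)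
  with Suc show ?case by simp
qed

lemma H_pet_eq_H_alg: "H_pet G \<phi> F = ereal (H_alg G \<phi> F)"
proof -
  \<comment> \<open>At \<open>n = 0\<close> both sides are divisions by zero, hence 0, whatever the
    undefined trajectory is.\<close>
  have eq: "nrm (pet G) (sg_traj (pet G) (pet_map \<phi>) F n) / real n = alg_growth G \<phi> F n" for n
  proof (cases n)
    case (Suc k)
    then show ?thesis
      using sg_traj_pet[of k] by (simp add: pet_def alg_growth_def)
  qed (simp add: alg_growth_def)
  have "alg_growth G \<phi> F \<longlonglongrightarrow> H_alg G \<phi> F"
    using convergent_alg_growth unfolding H_alg_def by (simp add: convergent_LIMSEQ_iff)
  \<comment> \<open>The real limit carries over to \<open>ereal\<close> by continuity, and a
    convergent sequence has its limit as upper limit.\<close>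
  then have "limsup (\<lambda>n. ereal (alg_growth G \<phi> F n)) = ereal (H_alg G \<phi> F)"
    by (intro lim_imp_Limsup) (auto intro: tendsto_intros)
  then show ?thesis
    unfolding H_pet_def sg_entropy_at_def eq .
qed

end

theorem theorem5p22:
  fixes G :: "('a, 'b) monoid_scheme" and \<phi> :: "'a \<Rightarrow> 'a"
  assumes "group G" and "\<phi> \<in> hom G G"
  shows "(\<forall>F \<in> fin_subsets G.
            convergent (alg_growth G \<phi> F) \<and> ereal (H_alg G \<phi> F) = H_pet G \<phi> F) \<and>
         h_alg G \<phi> = h_pet G \<phi>"
proof -
  \<comment> \<open>Both entropies are suprema over the same index set, because the carrier of
    \<open>pet G\<close> is \<open>fin_subsets G\<close>; pointwise equality therefore
    suffices.\<close>
  have "h_alg G \<phi> = (SUP F\<in>fin_subsets G. H_pet G \<phi> F)"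
    unfolding h_alg_def using H_pet_eq_H_alg[OF assms] by (intro SUP_cong) auto
  then show ?thesis
    using convergent_alg_growth[OF assms] H_pet_eq_H_alg[OF assms]
    by (simp add: h_pet_def sg_entropy_def H_pet_def pet_def)
qed

end
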